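(* Let $G$ be a topological group. (1) Let $(X,\mu)$ be a uniform $G$-space, $Y$ a dense $G$-subspace of $(X,\mu)$ and $y_0\in Y$. Then $y_0\in \mathrm{Eq}_X$ if and only if $y_0\in \mathrm{Eq}_Y$. (2) For every uniform $G$-space $(X,\mu)$, $\mathrm{SUC}_X\supset\mathrm{LE}_X\supset \mathrm{Eq}_X$. (3) For every $G$-space $X$, $\mathrm{SUC}(X)\supset\mathrm{LE}(X)$.
   Context: A $G$-space is a Tychonoff space with a continuous left action of $G$. A uniform $G$-space $(X,\mu)$ is a $G$-space whose topology is induced by the uniform structure $\mu$ and such that every translation $x\mapsto gx$ is a uniform isomorphism. Compact $G$-spaces carry their unique compatible uniformity. A $G$-subspace is a $G$-invariant subspace with the induced uniformity. $\mathrm{Eq}_X$ (points of equicontinuity): $x_0\in \mathrm{Eq}_X$ if for every $\varepsilon\in\mu$ there is a neighborhood $O$ of $x_0$ with $(gx_0,gx)\in\varepsilon$ for all $x\in O$, $g\in G$. $\mathrm{LE}_X$ (points of local equicontinuity): $x_0\in\mathrm{LE}_X$ if $x_0$ is a point of equicontinuity of the uniform $G$-subspace $\mathrm{cl}(Gx_0)$. $\mathrm{SUC}_X$: $x_0\in\mathrm{SUC}_X$ if for every $\varepsilon\in\mu$ there is a neighborhood $U$ of $e$ in $G$ with $(gux_0,gx_0)\in\varepsilon$ for all $g\in G$, $u\in U$. A compact $G$-space $Y$ is SUC (resp. LE) if $\mathrm{SUC}_Y=Y$ (resp. $\mathrm{LE}_Y=Y$). $\mathrm{SUC}(X)$ (resp.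 $\mathrm{LE}(X)$) is the set of bounded continuous $f\colon X\to\mathbb{R}$ of the form $f=F\circ\nu$ with $\nu\colon X\to Y$ a continuous $G$-equivariant map with dense image into a compact SUC (resp. LE) $G$-space $Y$ and $F\colon Y\to\mathbb{R}$ continuous. *)

theory Defs
  imports "HOL-Analysis.Analysis" "HOL-Algebra.Group_Action"
begin

text \<open>This notation of HOL-Algebra clashes with \<^const>\<open>closure_of\<close>.\<close>

no_notation eq_closure_of (\<open>closure'_of\<index>\<close>)

section \<open>Uniform structures on a carrier set\<close>

text \<open>
  As in the library class \<open>uniform_space\<close>, a uniform structure is the filter of its
  entourages, but on an arbitrary carrier set \<open>X\<close> rather than on a whole type:
  \<open>E\<close> is an entourage iff \<open>eventually E \<mu>\<close>.
\<close>

definition uniform_structure :: "'a set \<Rightarrow> ('a \<times> 'a) filter \<Rightarrow> bool" where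
  "uniform_structure X \<mu> \<longleftrightarrow>
     \<mu> \<le> principal (X \<times> X) \<and>
     (\<forall>E. eventually E \<mu> \<longrightarrow>
        (\<forall>x\<in>X. E (x, x)) \<and>
        eventually (\<lambda>(x, y). E (y, x)) \<mu> \<and>
        (\<exists>D. eventually D \<mu> \<and>
             (\<forall>x\<in>X. \<forall>y\<in>X. \<forall>z\<in>X. D (x, y) \<longrightarrow> D (y, z) \<longrightarrow> E (x, z))))"

definition uniform_topology :: "'a set \<Rightarrow> ('a \<times> 'a) filter \<Rightarrow> 'a topology" where
  "uniform_topology X \<mu> =
     topology (\<lambda>U. U \<subseteq> X \<and> (\<forall>x\<in>U. eventually (\<lambda>(x', y). x' = x \<longrightarrow> y \<in> U) \<mu>))"

definition subspace_uniformity :: "('a \<times> 'a) filter \<Rightarrow> 'a set \<Rightarrow> ('a \<times> 'a) filter" where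
  "subspace_uniformity \<mu> S = inf \<mu> (principal (S \<times> S))"

definition uniform_isomorphism ::
  "'a set \<Rightarrow> ('a \<times> 'a) filter \<Rightarrow> 'b set \<Rightarrow> ('b \<times> 'b) filter \<Rightarrow> ('a \<Rightarrow> 'b) \<Rightarrow> bool" where
  "uniform_isomorphism X \<mu> Y \<nu> f \<longleftrightarrow>
     bij_betw f X Y \<and>
     filterlim (map_prod f f) \<nu> \<mu> \<and>
     filterlim (map_prod (inv_into X f) (inv_into X f)) \<mu> \<nu>"

text \<open>
  The unique uniformity of a compact Hausdorff space; existence and uniqueness are
  \<open>compact_uniformity_ex1\<close> below.
\<close>

definition compact_uniformity :: "'a topology \<Rightarrow> ('a \<times> 'a) filter" where
  "compact_uniformity Y =
     (THE \<mu>. uniform_structure (topspace Y) \<mu> \<and> uniform_topology (topspace Y) \<mu> = Y)"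

section \<open>G-spaces\<close>

locale topological_group = group G for G (structure) +
  fixes T :: "'a topology"
  assumes topspace_eq_carrier: "topspace T = carrier G"
    and continuous_mult: "continuous_map (prod_topology T T) T (\<lambda>(g, h). g \<otimes> h)"
    and continuous_inv: "continuous_map T T (\<lambda>g. inv g)"

definition Tychonoff_space :: "'a topology \<Rightarrow> bool" where
  "Tychonoff_space X \<longleftrightarrow> completely_regular_space X \<and> Hausdorff_space X"

definition G_space ::
  "('g, 'm) monoid_scheme \<Rightarrow> 'g topology \<Rightarrow> 'a topology \<Rightarrow> ('g \<Rightarrow> 'a \<Rightarrow> 'a) \<Rightarrow> bool" where
  "G_space G T X \<phi> \<longleftrightarrow>
     Tychonoff_space X \<and>
     group_action G (topspace X) \<phi> \<and>
     continuous_map (prod_topology T X) X (\<lambda>(g, x). \<phi> g x)"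

definition uniform_G_space ::
  "('g, 'm) monoid_scheme \<Rightarrow> 'g topology \<Rightarrow> 'a set \<Rightarrow> ('a \<times> 'a) filter \<Rightarrow> ('g \<Rightarrow> 'a \<Rightarrow> 'a) \<Rightarrow> bool"
  where
  "uniform_G_space G T X \<mu> \<phi> \<longleftrightarrow>
     uniform_structure X \<mu> \<and>
     G_space G T (uniform_topology X \<mu>) \<phi> \<and>
     (\<forall>g\<in>carrier G. uniform_isomorphism X \<mu> X \<mu> (\<phi> g))"

definition G_invariant ::
  "('g, 'm) monoid_scheme \<Rightarrow> ('g \<Rightarrow> 'a \<Rightarrow> 'a) \<Rightarrow> 'a set \<Rightarrow> bool" where
  "G_invariant G \<phi> S \<longleftrightarrow> (\<forall>g\<in>carrier G. \<phi> g ` S \<subseteq> S)"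

text \<open>
  Actions in the sense of \<open>group_action\<close> are by extensional maps, so the action on an
  invariant subset has to be restricted to it.
\<close>

definition restrict_action :: "('g \<Rightarrow> 'a \<Rightarrow> 'a) \<Rightarrow> 'a set \<Rightarrow> 'g \<Rightarrow> 'a \<Rightarrow> 'a" where
  "restrict_action \<phi> S = (\<lambda>g. restrict (\<phi> g) S)"

section \<open>Points of equicontinuity, local equicontinuity and strong uniform continuity\<close>

definition Eq_points ::
  "('g, 'm) monoid_scheme \<Rightarrow> 'a set \<Rightarrow> ('a \<times> 'a) filter \<Rightarrow> ('g \<Rightarrow> 'a \<Rightarrow> 'a) \<Rightarrow> 'a set" where
  "Eq_points G X \<mu> \<phi> =
     {x\<^sub>0 \<in> X. \<forall>E. eventually E \<mu> \<longrightarrow>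
        (\<exists>U. openin (uniform_topology X \<mu>) U \<and> x\<^sub>0 \<in> U \<and>
             (\<forall>x\<in>U. \<forall>g\<in>carrier G. E (\<phi> g x\<^sub>0, \<phi> g x)))}"

definition LE_points ::
  "('g, 'm) monoid_scheme \<Rightarrow> 'a set \<Rightarrow> ('a \<times> 'a) filter \<Rightarrow> ('g \<Rightarrow> 'a \<Rightarrow> 'a) \<Rightarrow> 'a set" where
  "LE_points G X \<mu> \<phi> =
     {x\<^sub>0 \<in> X. let C = uniform_topology X \<mu> closure_of orbit G \<phi> x\<^sub>0
               in x\<^sub>0 \<in> Eq_points G C (subspace_uniformity \<mu> C) (restrict_action \<phi> C)}"

definition SUC_points ::
  "('g, 'm) monoid_scheme \<Rightarrow> 'g topology \<Rightarrow> 'a set \<Rightarrow> ('a \<times> 'a) filter \<Rightarrow> ('g \<Rightarrow> 'a \<Rightarrow> 'a) \<Rightarrow> 'a set"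
  where
  "SUC_points G T X \<mu> \<phi> =
     {x\<^sub>0 \<in> X. \<forall>E. eventually E \<mu> \<longrightarrow>
        (\<exists>U. openin T U \<and> \<one>\<^bsub>G\<^esub> \<in> U \<and>
             (\<forall>g\<in>carrier G. \<forall>u\<in>U. E (\<phi> (g \<otimes>\<^bsub>G\<^esub> u) x\<^sub>0, \<phi> g x\<^sub>0)))}"

section \<open>The function classes \<open>SUC(X)\<close> and \<open>LE(X)\<close>\<close>

definition compact_SUC_G_space ::
  "('g, 'm) monoid_scheme \<Rightarrow> 'g topology \<Rightarrow> 'a topology \<Rightarrow> ('g \<Rightarrow> 'a \<Rightarrow> 'a) \<Rightarrow> bool" where
  "compact_SUC_G_space G T Y \<psi> \<longleftrightarrow>
     G_space G T Y \<psi> \<and> compact_space Y \<and>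
     SUC_points G T (topspace Y) (compact_uniformity Y) \<psi> = topspace Y"

definition compact_LE_G_space ::
  "('g, 'm) monoid_scheme \<Rightarrow> 'g topology \<Rightarrow> 'a topology \<Rightarrow> ('g \<Rightarrow> 'a \<Rightarrow> 'a) \<Rightarrow> bool" where
  "compact_LE_G_space G T Y \<psi> \<longleftrightarrow>
     G_space G T Y \<psi> \<and> compact_space Y \<and>
     LE_points G (topspace Y) (compact_uniformity Y) \<psi> = topspace Y"

definition bounded_continuous :: "'a topology \<Rightarrow> ('a \<Rightarrow> real) \<Rightarrow> bool" where
  "bounded_continuous X f \<longleftrightarrow> continuous_map X euclideanreal f \<and> bounded (f ` topspace X)"

definition factors_through ::
  "('g, 'm) monoid_scheme \<Rightarrow> 'a topology \<Rightarrow> ('g \<Rightarrow> 'a \<Rightarrow> 'a) \<Rightarrow> 'b topology \<Rightarrow> ('g \<Rightarrow> 'b \<Rightarrow> 'b)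
     \<Rightarrow> ('a \<Rightarrow> real) \<Rightarrow> bool" where
  "factors_through G X \<phi> Y \<psi> f \<longleftrightarrow>
     (\<exists>\<nu> F. continuous_map X Y \<nu> \<and>
            (\<forall>g\<in>carrier G. \<forall>x\<in>topspace X. \<nu> (\<phi> g x) = \<psi> g (\<nu> x)) \<and>
            Y closure_of (\<nu> ` topspace X) = topspace Y \<and>
            continuous_map Y euclideanreal F \<and>
            (\<forall>x\<in>topspace X. f x = F (\<nu> x)))"

text \<open>
  HOL cannot quantify over the type of the points of \<open>Y\<close> inside a definition. A Hausdorff
  space containing a dense image of \<open>X\<close> injects into \<open>Pow (Pow X)\<close>, so it is no loss of
  generality to take \<open>Y\<close> with points in \<open>'a set set\<close>; see \<open>SUC_functions_any_type\<close> and
  \<open>LE_functions_any_type\<close> below. Functions are only considered on \<open>topspace X\<close>, their values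
  elsewhere being irrelevant.
\<close>

definition SUC_functions ::
  "('g, 'm) monoid_scheme \<Rightarrow> 'g topology \<Rightarrow> 'a topology \<Rightarrow> ('g \<Rightarrow> 'a \<Rightarrow> 'a) \<Rightarrow> ('a \<Rightarrow> real) set" where
  "SUC_functions G T X \<phi> =
     {f. bounded_continuous X f \<and>
         (\<exists>(Y :: 'a set set topology) \<psi>.
            compact_SUC_G_space G T Y \<psi> \<and> factors_through G X \<phi> Y \<psi> f)}"

definition LE_functions ::
  "('g, 'm) monoid_scheme \<Rightarrow> 'g topology \<Rightarrow> 'a topology \<Rightarrow> ('g \<Rightarrow> 'a \<Rightarrow> 'a) \<Rightarrow> ('a \<Rightarrow> real) set" where
  "LE_functions G T X \<phi> =
     {f. bounded_continuous X f \<and>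
         (\<exists>(Y :: 'a set set topology) \<psi>.
            compact_LE_G_space G T Y \<psi> \<and> factors_through G X \<phi> Y \<psi> f)}"

section \<open>Existence and uniqueness of the compact uniformity\<close>

lemma openin_uniform_topology:
  "openin (uniform_topology X \<mu>) U \<longleftrightarrow>
     U \<subseteq> X \<and> (\<forall>x\<in>U. eventually (\<lambda>(x', y). x' = x \<longrightarrow> y \<in> U) \<mu>)"
proof -
  have "istopology (\<lambda>U. U \<subseteq> X \<and> (\<forall>x\<in>U. eventually (\<lambda>(x', y). x' = x \<longrightarrow> y \<in> U) \<mu>))"
    unfolding istopology_def
  proof (intro conjI allI impI)
    fix S T
    assume S: "S \<subseteq> X \<and> (\<forall>x\<in>S. eventually (\<lambda>(x', y). x' = x \<longrightarrow> y \<in> S) \<mu>)"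
      and T: "T \<subseteq> X \<and> (\<forall>x\<in>T. eventually (\<lambda>(x', y). x' = x \<longrightarrow> y \<in> T) \<mu>)"
    then show "S \<inter> T \<subseteq> X" by blast
    show "\<forall>x\<in>S \<inter> T. eventually (\<lambda>(x', y). x' = x \<longrightarrow> y \<in> S \<inter> T) \<mu>"
    proof
      fix x assume "x \<in> S \<inter> T"
      with S T have "eventually (\<lambda>(x', y). x' = x \<longrightarrow> y \<in> S) \<mu>"
        and "eventually (\<lambda>(x', y). x' = x \<longrightarrow> y \<in> T) \<mu>" by auto
      then show "eventually (\<lambda>(x', y). x' = x \<longrightarrow> y \<in> S \<inter> T) \<mu>"
        by eventually_elim auto
    qed
  next
    fix \<K>
    assume K: "\<forall>K\<in>\<K>. K \<subseteq> X \<and> (\<forall>x\<in>K. eventually (\<lambda>(x', y). x' = x \<longrightarrow> y \<in> K) \<mu>)"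
    then show "\<Union>\<K> \<subseteq> X" by blast
    show "\<forall>x\<in>\<Union>\<K>. eventually (\<lambda>(x', y). x' = x \<longrightarrow> y \<in> \<Union>\<K>) \<mu>"
    proof
      fix x assume "x \<in> \<Union>\<K>"
      then obtain K where "K \<in> \<K>" "x \<in> K" by blast
      with K have "eventually (\<lambda>(x', y). x' = x \<longrightarrow> y \<in> K) \<mu>" by blast
      then show "eventually (\<lambda>(x', y). x' = x \<longrightarrow> y \<in> \<Union>\<K>) \<mu>"
        by eventually_elim (use \<open>K \<in> \<K>\<close> in auto)
    qed
  qed
  then show ?thesis
    by (simp add: uniform_topology_def topology_inverse')
qed

lemma uniform_structureD:
  assumes "uniform_structure X \<mu>"
  shows "\<mu> \<le> principal (X \<times> X)"
    and "\<And>E x. eventually E \<mu> \<Longrightarrow> x \<in> X \<Longrightarrow> E (x, x)"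
    and "\<And>E. eventually E \<mu> \<Longrightarrow> eventually (\<lambda>(x, y). E (y, x)) \<mu>"
    and "\<And>E. eventually E \<mu> \<Longrightarrow>
           \<exists>D. eventually D \<mu> \<and>
             (\<forall>x\<in>X. \<forall>y\<in>X. \<forall>z\<in>X. D (x, y) \<longrightarrow> D (y, z) \<longrightarrow> E (x, z))"
  using assms unfolding uniform_structure_def by blast+

lemma uniform_structure_carrier:
  "uniform_structure X \<mu> \<Longrightarrow> eventually (\<lambda>p. p \<in> X \<times> X) \<mu>"
  using uniform_structureD(1) by (auto simp: le_principal)

lemma compact_space_finite_subcover:
  assumes comp: "compact_space Y" and V: "\<And>x. x \<in> topspace Y \<Longrightarrow> openin Y (V x) \<and> x \<in> V x"
  shows "\<exists>F. finite F \<and> F \<subseteq> topspace Y \<and> topspace Y \<subseteq> \<Union>(V ` F)"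
proof -
  have "compactin Y (topspace Y)" using comp by (simp add: compact_space_def)
  moreover have "\<forall>U\<in>V ` topspace Y. openin Y U" using V by auto
  moreover have "topspace Y \<subseteq> \<Union>(V ` topspace Y)" using V by auto
  ultimately obtain \<F> where "finite \<F>" "\<F> \<subseteq> V ` topspace Y" "topspace Y \<subseteq> \<Union>\<F>"
    unfolding compactin_def by meson
  then show ?thesis by (metis finite_subset_image)
qed

text \<open>Entourage sections are neighbourhoods.\<close>

lemma uniform_section_neighbourhood:
  assumes U: "uniform_structure X \<mu>" and E: "eventually E \<mu>" and x: "x \<in> X"
  shows "\<exists>V. openin (uniform_topology X \<mu>) V \<and> x \<in> V \<and> (\<forall>y\<in>V. E (x, y))"
proof (intro exI conjI)
  define V where "V = {y \<in> X. \<exists>D. eventually D \<mu> \<and> (\<forall>z\<in>X. D (y, z) \<longrightarrow> E (x, z))}"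
  show "x \<in> V" using E x by (auto simp: V_def)
  show "\<forall>y\<in>V. E (x, y)"
    using uniform_structureD(2)[OF U] by (force simp: V_def)
  show "openin (uniform_topology X \<mu>) V"
    unfolding openin_uniform_topology
  proof (intro conjI ballI)
    show "V \<subseteq> X" by (auto simp: V_def)
    fix y assume "y \<in> V"
    then obtain D where y: "y \<in> X" and D: "eventually D \<mu>" "\<forall>z\<in>X. D (y, z) \<longrightarrow> E (x, z)"
      by (auto simp: V_def)
    obtain D' where D': "eventually D' \<mu>"
      and tr: "\<forall>x\<in>X. \<forall>y\<in>X. \<forall>z\<in>X. D' (x, y) \<longrightarrow> D' (y, z) \<longrightarrow> D (x, z)"
      using uniform_structureD(4)[OF U D(1)] by blast
    show "eventually (\<lambda>(x', z). x' = y \<longrightarrow> z \<in> V) \<mu>"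
      using D' uniform_structure_carrier[OF U]
    proof eventually_elim
      case (elim p)
      then show ?case
        using D' tr D(2) by (auto simp: V_def split: prod.splits intro!: exI[of _ D'])
    qed
  qed
qed

lemma compact_uniform_entourages:
  assumes U: "uniform_structure (topspace Y) \<mu>" and top: "uniform_topology (topspace Y) \<mu> = Y"
    and comp: "compact_space Y"
  shows "eventually E \<mu> \<longleftrightarrow>
           (\<exists>W. openin (prod_topology Y Y) W \<and> (\<forall>y\<in>topspace Y. (y, y) \<in> W) \<and> (\<forall>p\<in>W. E p))"
    (is "?L \<longleftrightarrow> ?R")
proof
  assume E: ?L
  obtain D where D: "eventually D \<mu>"
    and tr: "\<forall>x\<in>topspace Y. \<forall>y\<in>topspace Y. \<forall>z\<in>topspace Y. D (x, y) \<longrightarrow> D (y, z) \<longrightarrow> E (x, z)"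
    using uniform_structureD(4)[OF U E] by blast
  have D': "eventually (\<lambda>(x, y). D (x, y) \<and> D (y, x)) \<mu>"
    using eventually_conj[OF D uniform_structureD(3)[OF U D]] by (rule eventually_mono) auto
  have "\<forall>x\<in>topspace Y. \<exists>V. openin Y V \<and> x \<in> V \<and> (\<forall>y\<in>V. D (x, y) \<and> D (y, x))"
    using uniform_section_neighbourhood[OF U D'] unfolding top by simp
  then obtain V where V: "\<And>x. x \<in> topspace Y \<Longrightarrow>
      openin Y (V x) \<and> x \<in> V x \<and> (\<forall>y\<in>V x. D (x, y) \<and> D (y, x))"
    by metis
  show ?R
  proof (intro exI conjI)
    show "openin (prod_topology Y Y) (\<Union>x\<in>topspace Y. V x \<times> V x)"
      using V by (auto simp: openin_prod_Times_iff)
    show "\<forall>y\<in>topspace Y. (y, y) \<in> (\<Union>x\<in>topspace Y. V x \<times> V x)" using V by blast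
    show "\<forall>p\<in>\<Union>x\<in>topspace Y. V x \<times> V x. E p"
    proof clarify
      fix x a b assume x: "x \<in> topspace Y" and ab: "a \<in> V x" "b \<in> V x"
      then have "a \<in> topspace Y" "b \<in> topspace Y" using V openin_subset by blast+
      then show "E (a, b)" using tr V[OF x] ab x by blast
    qed
  qed
next
  assume ?R
  then obtain W where W: "openin (prod_topology Y Y) W" "\<forall>y\<in>topspace Y. (y, y) \<in> W" "\<forall>p\<in>W. E p"
    by blast
  have "\<exists>V D. openin Y V \<and> x \<in> V \<and> eventually D \<mu> \<and>
          (\<forall>a\<in>V. \<forall>b\<in>topspace Y. D (a, b) \<longrightarrow> E (a, b))" if x: "x \<in> topspace Y" for x
  proof -
    have "(x, x) \<in> W" using W(2) x by blast
    then obtain A B where "openin Y A" "openin Y B" "x \<in> A" "x \<in> B" "A \<times> B \<subseteq> W"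
      using W(1) unfolding openin_prod_topology_alt by meson
    then have O: "openin Y (A \<inter> B)" "x \<in> A \<inter> B" and AB: "(A \<inter> B) \<times> (A \<inter> B) \<subseteq> W" by auto
    define P where "P = (\<lambda>(x', y). x' = x \<longrightarrow> y \<in> A \<inter> B)"
    have "openin (uniform_topology (topspace Y) \<mu>) (A \<inter> B)"
      using O top by simp
    then have "eventually P \<mu>"
      using O unfolding P_def openin_uniform_topology by blast
    then obtain D where D: "eventually D \<mu>"
      and tr: "\<forall>u\<in>topspace Y. \<forall>y\<in>topspace Y. \<forall>z\<in>topspace Y. D (u, y) \<longrightarrow> D (y, z) \<longrightarrow> P (u, z)"
      using uniform_structureD(4)[OF U, of P] by blast
    obtain V where V: "openin Y V" "x \<in> V" "\<forall>y\<in>V. D (x, y)"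
      using uniform_section_neighbourhood[OF U D x] unfolding top by blast
    have "E (a, b)" if "a \<in> V" "b \<in> topspace Y" "D (a, b)" for a b
    proof -
      have a: "a \<in> topspace Y" using V that openin_subset by blast
      have "P (x, b)" using tr x a that V by blast
      then have "b \<in> A \<inter> B" by (simp add: P_def)
      moreover have "P (x, a)" using tr x a that V uniform_structureD(2)[OF U D a] by blast
      then have "a \<in> A \<inter> B" by (simp add: P_def)
      ultimately show ?thesis using AB W(3) by blast
    qed
    then show ?thesis using V D by blast
  qed
  then obtain V D where VD: "\<And>x. x \<in> topspace Y \<Longrightarrow> openin Y (V x) \<and> x \<in> V x \<and> eventually (D x) \<mu> \<and>
          (\<forall>a\<in>V x. \<forall>b\<in>topspace Y. D x (a, b) \<longrightarrow> E (a, b))"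
    by metis
  have VO: "openin Y (V x) \<and> x \<in> V x" if "x \<in> topspace Y" for x
    using VD[OF that] by simp
  obtain F where F: "finite F" "F \<subseteq> topspace Y" "topspace Y \<subseteq> \<Union>(V ` F)"
    using compact_space_finite_subcover[OF comp VO] by blast
  have VE: "E (a, b)" if "x \<in> F" "a \<in> V x" "b \<in> topspace Y" "D x (a, b)" for x a b
    using VD[of x] F(2) that by auto
  have VDx: "eventually (D x) \<mu>" if "x \<in> F" for x
    using VD[of x] F(2) that by auto
  have "eventually (\<lambda>p. \<forall>x\<in>F. D x p) \<mu>"
    using F(1) VDx by (intro eventually_ball_finite) auto
  then show ?L
    using uniform_structure_carrier[OF U]
  proof eventually_elim
    case (elim p)
    obtain a b where p: "p = (a, b)" by (cases p)
    then obtain x where "x \<in> F" "a \<in> V x" using elim F(3) by auto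
    then show ?case using elim VE p by auto
  qed
qed

lemma compact_uniformity_exists:
  assumes comp: "compact_space Y" and haus: "Hausdorff_space Y"
  shows "\<exists>\<mu>. uniform_structure (topspace Y) \<mu> \<and> uniform_topology (topspace Y) \<mu> = Y"
proof -
  define N where "N E \<longleftrightarrow>
    (\<exists>W. openin (prod_topology Y Y) W \<and> (\<forall>y\<in>topspace Y. (y, y) \<in> W) \<and> (\<forall>p\<in>W. E p))" for E
  have NI: "N E" if "openin (prod_topology Y Y) W" "\<And>y. y \<in> topspace Y \<Longrightarrow> (y, y) \<in> W"
      "\<And>p. p \<in> W \<Longrightarrow> E p" for E W
    unfolding N_def using that by blast
  have NE: "\<exists>W. openin (prod_topology Y Y) W \<and> (\<forall>y\<in>topspace Y. (y, y) \<in> W) \<and> (\<forall>p\<in>W. E p)"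
    if "N E" for E
    using that unfolding N_def .
  have filt: "is_filter N"
  proof
    show "N (\<lambda>x. True)"
      by (rule NI[OF openin_topspace]) auto
    show "N (\<lambda>x. P x \<and> Q x)" if PQ: "N P" "N Q" for P Q
    proof -
      obtain V where V: "openin (prod_topology Y Y) V" "\<forall>y\<in>topspace Y. (y, y) \<in> V" "\<forall>p\<in>V. P p"
        using NE[OF PQ(1)] by blast
      obtain W where W: "openin (prod_topology Y Y) W" "\<forall>y\<in>topspace Y. (y, y) \<in> W" "\<forall>p\<in>W. Q p"
        using NE[OF PQ(2)] by blast
      show ?thesis
        by (rule NI[OF openin_Int[OF V(1) W(1)]]) (use V W in auto)
    qed
    show "N Q" if PQ: "\<forall>x. P x \<longrightarrow> Q x" "N P" for P Q
    proof -
      obtain W where W: "openin (prod_topology Y Y) W" "\<forall>y\<in>topspace Y. (y, y) \<in> W" "\<forall>p\<in>W. P p"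
        using NE[OF PQ(2)] by blast
      show ?thesis
        by (rule NI[OF W(1)]) (use W PQ(1) in auto)
    qed
  qed
  define \<mu> where "\<mu> = Abs_filter N"
  have ev: "eventually E \<mu> \<longleftrightarrow> N E" for E
    unfolding \<mu>_def by (rule eventually_Abs_filter[OF filt])
  have reg: "regular_space Y"
    by (rule compact_Hausdorff_imp_regular_space[OF comp haus])
  have "uniform_structure (topspace Y) \<mu>"
    unfolding uniform_structure_def
  proof (intro conjI allI impI ballI)
    show "\<mu> \<le> principal (topspace Y \<times> topspace Y)"
      unfolding le_principal ev by (rule NI[OF openin_topspace]) auto
  next
    fix E x assume "eventually E \<mu>" "x \<in> topspace Y"
    then show "E (x, x)" unfolding ev using NE[of E] by blast
  next
    fix E assume "eventually E \<mu>"
    then obtain W where W: "openin (prod_topology Y Y) W" "\<forall>y\<in>topspace Y. (y, y) \<in> W" "\<forall>p\<in>W. E p"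
      unfolding ev using NE[of E] by blast
    have "openin (prod_topology Y Y) (prod.swap ` W)"
      unfolding openin_prod_topology_alt
    proof (intro allI impI)
      fix x y assume "(x, y) \<in> prod.swap ` W"
      then have "(y, x) \<in> W" by auto
      then obtain A B where "openin Y A" "openin Y B" "y \<in> A" "x \<in> B" "A \<times> B \<subseteq> W"
        using W(1) unfolding openin_prod_topology_alt by meson
      then show "\<exists>U V. openin Y U \<and> openin Y V \<and> x \<in> U \<and> y \<in> V \<and> U \<times> V \<subseteq> prod.swap ` W"
        by (intro exI[of _ B] exI[of _ A]) force
    qed
    then show "eventually (\<lambda>(x, y). E (y, x)) \<mu>"
      unfolding ev by (rule NI) (use W in force)+
  next
    fix E assume "eventually E \<mu>"
    then obtain W where W: "openin (prod_topology Y Y) W" "\<forall>y\<in>topspace Y. (y, y) \<in> W" "\<forall>p\<in>W. E p"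
      unfolding ev using NE[of E] by blast
    have "\<exists>U V C. openin Y U \<and> U \<times> U \<subseteq> W \<and> openin Y V \<and> closedin Y C \<and> x \<in> V \<and> V \<subseteq> C \<and> C \<subseteq> U"
      if x: "x \<in> topspace Y" for x
    proof -
      have "(x, x) \<in> W" using W(2) x by blast
      then obtain A B where "openin Y A" "openin Y B" "x \<in> A" "x \<in> B" "A \<times> B \<subseteq> W"
        using W(1) unfolding openin_prod_topology_alt by meson
      then have O: "openin Y (A \<inter> B)" "x \<in> A \<inter> B" and AB: "(A \<inter> B) \<times> (A \<inter> B) \<subseteq> W" by auto
      obtain V C where "openin Y V" "closedin Y C" "x \<in> V" "V \<subseteq> C" "C \<subseteq> A \<inter> B"
        using reg O unfolding neighbourhood_base_of_closedin[symmetric] neighbourhood_base_of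
        by meson
      then show ?thesis using O AB by blast
    qed
    then obtain U V C where UVC: "\<And>x. x \<in> topspace Y \<Longrightarrow> openin Y (U x) \<and> U x \<times> U x \<subseteq> W \<and>
        openin Y (V x) \<and> closedin Y (C x) \<and> x \<in> V x \<and> V x \<subseteq> C x \<and> C x \<subseteq> U x"
      by metis
    have VO: "openin Y (V x) \<and> x \<in> V x" if "x \<in> topspace Y" for x
      using UVC[OF that] by auto
    obtain F where F: "finite F" "F \<subseteq> topspace Y" "topspace Y \<subseteq> \<Union>(V ` F)"
      using compact_space_finite_subcover[OF comp VO] by blast
    define Q where "Q x = U x \<times> U x \<union> (topspace Y - C x) \<times> (topspace Y - C x)" for x
    have "openin (prod_topology Y Y) (Q x)" if "x \<in> topspace Y" for x
      unfolding Q_def using UVC[OF that]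
      by (intro openin_Un) (auto simp: openin_prod_Times_iff)
    then have NQ: "N (\<lambda>p. p \<in> Q x)" if "x \<in> F" for x
      by (rule NI[of "Q x"]) (use that F(2) UVC[of x] in \<open>auto simp: Q_def\<close>)
    have "eventually (\<lambda>p. \<forall>x\<in>F. p \<in> Q x) \<mu>"
      using F NQ by (intro eventually_ball_finite) (auto simp: ev)
    moreover have "E (a, c)"
      if Y: "a \<in> topspace Y" "b \<in> topspace Y" "c \<in> topspace Y"
        and Q: "\<forall>x\<in>F. (a, b) \<in> Q x" "\<forall>x\<in>F. (b, c) \<in> Q x" for a b c
    proof -
      obtain x where x: "x \<in> F" "b \<in> V x" using F(3) Y(2) by auto
      then have "b \<in> C x" using F(2) UVC[of x] by auto
      then have "a \<in> U x" "c \<in> U x" using Q x by (auto simp: Q_def)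
      then have "(a, c) \<in> W" using UVC[of x] x F(2) by auto
      then show ?thesis using W(3) by blast
    qed
    ultimately show "\<exists>D. eventually D \<mu> \<and> (\<forall>x\<in>topspace Y. \<forall>y\<in>topspace Y. \<forall>z\<in>topspace Y.
        D (x, y) \<longrightarrow> D (y, z) \<longrightarrow> E (x, z))"
      by blast
  qed
  moreover have "uniform_topology (topspace Y) \<mu> = Y"
    unfolding topology_eq openin_uniform_topology
  proof (intro allI iffI conjI ballI)
    fix U assume U: "U \<subseteq> topspace Y \<and> (\<forall>x\<in>U. eventually (\<lambda>(x', y). x' = x \<longrightarrow> y \<in> U) \<mu>)"
    show "openin Y U"
    proof (subst openin_subopen, intro ballI)
      fix x assume x: "x \<in> U"
      define P where "P = (\<lambda>(x', y). x' = x \<longrightarrow> y \<in> U)"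
      have "N P" using U x unfolding ev P_def by blast
      then obtain W where W: "openin (prod_topology Y Y) W" "\<forall>y\<in>topspace Y. (y, y) \<in> W" "\<forall>p\<in>W. P p"
        using NE by blast
      have "(x, x) \<in> W" using W(2) U x by blast
      then obtain A B where "openin Y A" "openin Y B" "x \<in> A" "x \<in> B" "A \<times> B \<subseteq> W"
        using W(1) unfolding openin_prod_topology_alt by meson
      then show "\<exists>T. openin Y T \<and> x \<in> T \<and> T \<subseteq> U"
        using W(3) unfolding P_def by (intro exI[of _ B]) auto
    qed
  next
    fix U assume "openin Y U" then show "U \<subseteq> topspace Y" by (rule openin_subset)
  next
    fix U x assume U: "openin Y U" and x: "x \<in> U"
    have xY: "x \<in> topspace Y" using U x openin_subset by blast
    have "closedin Y {x}"
      using haus xY by (simp add: closedin_Hausdorff_singleton)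
    then have "openin (prod_topology Y Y) ((topspace Y - {x}) \<times> topspace Y \<union> U \<times> U)"
      using U by (intro openin_Un) (auto simp: openin_prod_Times_iff)
    then show "eventually (\<lambda>(x', y). x' = x \<longrightarrow> y \<in> U) \<mu>"
      unfolding ev by (rule NI) (use x in auto)
  qed
  ultimately show ?thesis by blast
qed

theorem compact_uniformity_ex1:
  assumes "compact_space Y" "Hausdorff_space Y"
  shows "\<exists>!\<mu>. uniform_structure (topspace Y) \<mu> \<and> uniform_topology (topspace Y) \<mu> = Y"
proof (rule ex_ex1I)
  show "\<exists>\<mu>. uniform_structure (topspace Y) \<mu> \<and> uniform_topology (topspace Y) \<mu> = Y"
    by (rule compact_uniformity_exists[OF assms])
  fix \<mu> \<nu>
  assume \<mu>: "uniform_structure (topspace Y) \<mu> \<and> uniform_topology (topspace Y) \<mu> = Y"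
    and \<nu>: "uniform_structure (topspace Y) \<nu> \<and> uniform_topology (topspace Y) \<nu> = Y"
  show "\<mu> = \<nu>"
    unfolding filter_eq_iff
    using compact_uniform_entourages[OF conjunct1[OF \<mu>] conjunct2[OF \<mu>] assms(1)]
      compact_uniform_entourages[OF conjunct1[OF \<nu>] conjunct2[OF \<nu>] assms(1)]
    by simp
qed

lemma compact_uniformity:
  assumes "compact_space Y" "Hausdorff_space Y"
  shows "uniform_structure (topspace Y) (compact_uniformity Y)"
    and "uniform_topology (topspace Y) (compact_uniformity Y) = Y"
  using theI'[OF compact_uniformity_ex1[OF assms]] unfolding compact_uniformity_def by simp_all

lemma compact_uniformity_eqI:
  assumes "compact_space Y" "Hausdorff_space Y"
    and "uniform_structure (topspace Y) \<mu>" "uniform_topology (topspace Y) \<mu> = Y"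
  shows "compact_uniformity Y = \<mu>"
  unfolding compact_uniformity_def
  by (rule the1_equality[OF compact_uniformity_ex1[OF assms(1,2)]]) (use assms(3,4) in simp)

section \<open>Independence of the type of the points of \<open>Y\<close>\<close>

abbreviation push_uniformity :: "('a \<Rightarrow> 'b) \<Rightarrow> ('a \<times> 'a) filter \<Rightarrow> ('b \<times> 'b) filter" where
  "push_uniformity h \<mu> \<equiv> filtermap (map_prod h h) \<mu>"

lemma openin_uniform_topology_push:
  assumes inj: "inj_on h X" and le: "\<mu> \<le> principal (X \<times> X)" and U: "U \<subseteq> X"
  shows "openin (uniform_topology (h ` X) (push_uniformity h \<mu>)) (h ` U) \<longleftrightarrow>
         openin (uniform_topology X \<mu>) U"
proof -
  have ev: "eventually (\<lambda>p. p \<in> X \<times> X) \<mu>" using le by (auto simp: le_principal)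
  have eqv: "eventually (\<lambda>(x', y). x' = h x \<longrightarrow> y \<in> h ` U) (push_uniformity h \<mu>) \<longleftrightarrow>
        eventually (\<lambda>(x', y). x' = x \<longrightarrow> y \<in> U) \<mu>" if x: "x \<in> U" for x
    unfolding eventually_filtermap
  proof (rule eventually_cong[OF ev])
    fix p assume "p \<in> X \<times> X"
    then obtain a b where p: "p = (a, b)" and X: "a \<in> X" "b \<in> X" by blast
    have "h a = h x \<longleftrightarrow> a = x"
      using inj_on_eq_iff[OF inj X(1)] x U by blast
    moreover have "h b \<in> h ` U \<longleftrightarrow> b \<in> U"
      using inj_on_image_mem_iff[OF inj X(2) U] .
    ultimately show "(case map_prod h h p of (x', y) \<Rightarrow> x' = h x \<longrightarrow> y \<in> h ` U) \<longleftrightarrow>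
               (case p of (x', y) \<Rightarrow> x' = x \<longrightarrow> y \<in> U)"
      by (simp add: p)
  qed
  show ?thesis
    unfolding openin_uniform_topology ball_simps(9)
    using U image_mono[OF U, of h] eqv by (simp cong: ball_cong)
qed

lemma uniform_structure_push:
  assumes inj: "inj_on h X" and us: "uniform_structure X \<mu>"
  shows "uniform_structure (h ` X) (push_uniformity h \<mu>)"
  unfolding uniform_structure_def
proof (intro conjI allI impI ballI)
  show "push_uniformity h \<mu> \<le> principal (h ` X \<times> h ` X)"
    using uniform_structure_carrier[OF us]
    by (auto simp: le_principal eventually_filtermap elim!: eventually_mono)
next
  fix E z assume "eventually E (push_uniformity h \<mu>)" "z \<in> h ` X"
  then show "E (z, z)"
    using uniform_structureD(2)[OF us, of "\<lambda>p. E (map_prod h h p)"]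
    by (auto simp: eventually_filtermap)
next
  fix E assume "eventually E (push_uniformity h \<mu>)"
  then show "eventually (\<lambda>(x, y). E (y, x)) (push_uniformity h \<mu>)"
    using uniform_structureD(3)[OF us, of "\<lambda>p. E (map_prod h h p)"]
    by (simp add: eventually_filtermap case_prod_unfold)
next
  fix E assume "eventually E (push_uniformity h \<mu>)"
  then have "eventually (\<lambda>p. E (map_prod h h p)) \<mu>" by (simp add: eventually_filtermap)
  from uniform_structureD(4)[OF us this] obtain D where D: "eventually D \<mu>"
    and tr: "\<forall>x\<in>X. \<forall>y\<in>X. \<forall>z\<in>X. D (x, y) \<longrightarrow> D (y, z) \<longrightarrow> E (map_prod h h (x, z))"
    by blast
  define k where "k = inv_into X h"
  have k: "k (h x) = x" if "x \<in> X" for x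
    using inj that by (simp add: k_def)
  show "\<exists>D. eventually D (push_uniformity h \<mu>) \<and>
          (\<forall>x\<in>h ` X. \<forall>y\<in>h ` X. \<forall>z\<in>h ` X. D (x, y) \<longrightarrow> D (y, z) \<longrightarrow> E (x, z))"
  proof (intro exI[of _ "\<lambda>p. D (map_prod k k p)"] conjI)
    show "eventually (\<lambda>p. D (map_prod k k p)) (push_uniformity h \<mu>)"
      unfolding eventually_filtermap
      using D uniform_structure_carrier[OF us] by eventually_elim (auto simp: k)
    show "\<forall>x\<in>h ` X. \<forall>y\<in>h ` X. \<forall>z\<in>h ` X.
        D (map_prod k k (x, y)) \<longrightarrow> D (map_prod k k (y, z)) \<longrightarrow> E (x, z)"
      using tr by (auto simp: k)
  qed
qed

lemma compact_uniformity_push: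
  assumes comp: "compact_space Y" "Hausdorff_space Y" and hom: "homeomorphic_map Y Y' h"
  shows "compact_uniformity Y' = push_uniformity h (compact_uniformity Y)"
proof (rule compact_uniformity_eqI)
  have sp: "Y homeomorphic_space Y'" using hom homeomorphic_map_imp_homeomorphic_space by blast
  show "compact_space Y'" "Hausdorff_space Y'"
    using comp sp homeomorphic_compact_space homeomorphic_Hausdorff_space by blast+
  have inj: "inj_on h (topspace Y)" and im: "h ` topspace Y = topspace Y'"
    using hom homeomorphic_imp_injective_map homeomorphic_imp_surjective_map by blast+
  note us = compact_uniformity[OF comp]
  show "uniform_structure (topspace Y') (push_uniformity h (compact_uniformity Y))"
    using uniform_structure_push[OF inj us(1)] im by simp
  show "uniform_topology (topspace Y') (push_uniformity h (compact_uniformity Y)) = Y'"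
    unfolding topology_eq
  proof
    fix V
    show "openin (uniform_topology (topspace Y') (push_uniformity h (compact_uniformity Y))) V
          \<longleftrightarrow> openin Y' V"
    proof (cases "V \<subseteq> topspace Y'")
      case True
      then obtain U where U: "U \<subseteq> topspace Y" "V = h ` U"
        using im by (metis subset_image_iff)
      show ?thesis
        unfolding U(2) im[symmetric]
          openin_uniform_topology_push[OF inj uniform_structureD(1)[OF us(1)] U(1)] us(2)
        using homeomorphic_map_openness[OF hom U(1)] by simp
    next
      case False
      then show ?thesis
        using openin_subset by (auto simp: openin_uniform_topology)
    qed
  qed
qed

lemma SUC_pointsD:
  assumes "x \<in> SUC_points G T X \<mu> \<psi>" "eventually E \<mu>"
  shows "\<exists>U. openin T U \<and> \<one>\<^bsub>G\<^esub> \<in> U \<and>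
           (\<forall>g\<in>carrier G. \<forall>u\<in>U. E (\<psi> (g \<otimes>\<^bsub>G\<^esub> u) x, \<psi> g x))"
  using assms by (simp add: SUC_points_def)

lemma Eq_pointsD:
  assumes "x \<in> Eq_points G X \<mu> \<psi>" "eventually E \<mu>"
  shows "\<exists>U. openin (uniform_topology X \<mu>) U \<and> x \<in> U \<and>
           (\<forall>y\<in>U. \<forall>g\<in>carrier G. E (\<psi> g x, \<psi> g y))"
  using assms by (simp add: Eq_points_def)

lemma SUC_points_push:
  assumes tg: "topological_group G T" and inj: "inj_on h X"
    and eqv: "\<And>g x. g \<in> carrier G \<Longrightarrow> x \<in> X \<Longrightarrow> \<psi>' g (h x) = h (\<psi> g x)"
    and x: "x \<in> SUC_points G T X \<mu> \<psi>"
  shows "h x \<in> SUC_points G T (h ` X) (push_uniformity h \<mu>) \<psi>'"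
  unfolding SUC_points_def
proof (intro CollectI conjI allI impI)
  have xX: "x \<in> X" using x by (simp add: SUC_points_def)
  then show "h x \<in> h ` X" by blast
  interpret topological_group G T by (rule tg)
  fix E assume "eventually E (push_uniformity h \<mu>)"
  then have ev: "eventually (\<lambda>p. E (map_prod h h p)) \<mu>" by (simp add: eventually_filtermap)
  from SUC_pointsD[OF x ev] obtain U where U: "openin T U" "\<one>\<^bsub>G\<^esub> \<in> U"
    and E: "\<forall>g\<in>carrier G. \<forall>u\<in>U. E (map_prod h h (\<psi> (g \<otimes>\<^bsub>G\<^esub> u) x, \<psi> g x))"
    by (elim exE conjE)
  have "U \<subseteq> carrier G" using openin_subset[OF U(1)] topspace_eq_carrier by simp
  then have "\<forall>g\<in>carrier G. \<forall>u\<in>U. E (\<psi>' (g \<otimes>\<^bsub>G\<^esub> u) (h x), \<psi>' g (h x))"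
    using E eqv xX by (auto simp: subset_iff)
  then show "\<exists>U. openin T U \<and> \<one>\<^bsub>G\<^esub> \<in> U \<and>
      (\<forall>g\<in>carrier G. \<forall>u\<in>U. E (\<psi>' (g \<otimes>\<^bsub>G\<^esub> u) (h x), \<psi>' g (h x)))"
    using U by blast
qed

lemma Eq_points_push:
  assumes inj: "inj_on h X" and le: "\<mu> \<le> principal (X \<times> X)"
    and eqv: "\<And>g x. g \<in> carrier G \<Longrightarrow> x \<in> X \<Longrightarrow> \<psi>' g (h x) = h (\<psi> g x)"
    and x: "x \<in> Eq_points G X \<mu> \<psi>"
  shows "h x \<in> Eq_points G (h ` X) (push_uniformity h \<mu>) \<psi>'"
  unfolding Eq_points_def
proof (intro CollectI conjI allI impI)
  have xX: "x \<in> X" using x by (simp add: Eq_points_def)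
  then show "h x \<in> h ` X" by blast
  fix E assume "eventually E (push_uniformity h \<mu>)"
  then have ev: "eventually (\<lambda>p. E (map_prod h h p)) \<mu>" by (simp add: eventually_filtermap)
  from Eq_pointsD[OF x ev] obtain U where U: "openin (uniform_topology X \<mu>) U" "x \<in> U"
    and E: "\<forall>y\<in>U. \<forall>g\<in>carrier G. E (map_prod h h (\<psi> g x, \<psi> g y))"
    by (elim exE conjE)
  have UX: "U \<subseteq> X" using U(1) by (simp add: openin_uniform_topology)
  have "openin (uniform_topology (h ` X) (push_uniformity h \<mu>)) (h ` U)"
    using openin_uniform_topology_push[OF inj le UX] U(1) by simp
  moreover have "\<forall>y\<in>h ` U. \<forall>g\<in>carrier G. E (\<psi>' g (h x), \<psi>' g y)"
    using E eqv xX UX by (auto simp: subset_iff)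
  ultimately show "\<exists>V. openin (uniform_topology (h ` X) (push_uniformity h \<mu>)) V \<and> h x \<in> V \<and>
      (\<forall>y\<in>V. \<forall>g\<in>carrier G. E (\<psi>' g (h x), \<psi>' g y))"
    using U(2) by blast
qed

lemma subspace_uniformity_push:
  assumes inj: "inj_on h X" and le: "\<mu> \<le> principal (X \<times> X)" and C: "C \<subseteq> X"
  shows "subspace_uniformity (push_uniformity h \<mu>) (h ` C) =
         push_uniformity h (subspace_uniformity \<mu> C)"
  unfolding filter_eq_iff subspace_uniformity_def eventually_filtermap eventually_inf_principal
proof (intro allI eventually_cong)
  show "eventually (\<lambda>p. p \<in> X \<times> X) \<mu>" using le by (auto simp: le_principal)
  fix E p assume p: "p \<in> X \<times> X"
  have mem: "h a \<in> h ` C \<longleftrightarrow> a \<in> C" if "a \<in> X" for a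
    using inj_on_image_mem_iff[OF inj that C] .
  show "(map_prod h h p \<in> h ` C \<times> h ` C \<longrightarrow> E (map_prod h h p)) \<longleftrightarrow>
             (p \<in> C \<times> C \<longrightarrow> E (map_prod h h p))"
    using p by (cases p) (simp add: mem)
qed

lemma uniform_topology_closure_of_push:
  assumes inj: "inj_on h X" and le: "\<mu> \<le> principal (X \<times> X)" and S: "S \<subseteq> X"
  shows "uniform_topology (h ` X) (push_uniformity h \<mu>) closure_of (h ` S) =
         h ` (uniform_topology X \<mu> closure_of S)"
proof (rule homeomorphic_map_closure_of)
  have top: "topspace (uniform_topology X \<nu>) = X" if "\<nu> \<le> principal (X \<times> X)"
    for X :: "'z set" and \<nu>
  proof -
    have "eventually (\<lambda>p. p \<in> X \<times> X) \<nu>" using that by (simp add: le_principal)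
    then have "openin (uniform_topology X \<nu>) X"
      by (auto simp: openin_uniform_topology elim!: eventually_mono)
    then show ?thesis
      by (intro equalityI openin_subset) (auto simp: topspace_def openin_uniform_topology)
  qed
  have le': "push_uniformity h \<mu> \<le> principal (h ` X \<times> h ` X)"
    using le by (auto simp: le_principal eventually_filtermap elim!: eventually_mono)
  show "homeomorphic_map (uniform_topology X \<mu>) (uniform_topology (h ` X) (push_uniformity h \<mu>)) h"
    (is "homeomorphic_map ?A ?B h")
  proof (rule bijective_open_imp_homeomorphic_map)
    show "continuous_map ?A ?B h"
      unfolding continuous_map_def top[OF le] top[OF le']
    proof (intro conjI allI impI)
      show "h \<in> X \<rightarrow> h ` X" by blast
      fix V assume V: "openin ?B V"
      then have "V \<subseteq> h ` X" using openin_subset top[OF le'] by blast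
      then have "V = h ` {x \<in> X. h x \<in> V}" by blast
      then show "openin ?A {x \<in> X. h x \<in> V}"
        using openin_uniform_topology_push[OF inj le, of "{x \<in> X. h x \<in> V}"] V by auto
    qed
    show "open_map ?A ?B h"
      unfolding open_map_def
    proof (intro allI impI)
      fix U assume U: "openin ?A U"
      then have "U \<subseteq> X" using openin_subset top[OF le] by blast
      then show "openin ?B (h ` U)"
        using openin_uniform_topology_push[OF inj le] U by blast
    qed
  qed (simp_all add: top[OF le] top[OF le'] inj)
  show "S \<subseteq> topspace (uniform_topology X \<mu>)" using S top[OF le] by simp
qed

lemma LE_points_push:
  assumes inj: "inj_on h X" and le: "\<mu> \<le> principal (X \<times> X)"
    and act: "\<And>g x. g \<in> carrier G \<Longrightarrow> x \<in> X \<Longrightarrow> \<psi> g x \<in> X"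
    and eqv: "\<And>g x. g \<in> carrier G \<Longrightarrow> x \<in> X \<Longrightarrow> \<psi>' g (h x) = h (\<psi> g x)"
    and x: "x \<in> LE_points G X \<mu> \<psi>"
  shows "h x \<in> LE_points G (h ` X) (push_uniformity h \<mu>) \<psi>'"
proof -
  define C where "C = uniform_topology X \<mu> closure_of orbit G \<psi> x"
  have xX: "x \<in> X" and xC: "x \<in> Eq_points G C (subspace_uniformity \<mu> C) (restrict_action \<psi> C)"
    using x by (auto simp: LE_points_def C_def Let_def)
  have orb: "orbit G \<psi> x \<subseteq> X" and orb': "orbit G \<psi>' (h x) = h ` orbit G \<psi> x"
    using act eqv xX by (auto simp: orbit_def image_iff) metis+
  have C': "uniform_topology (h ` X) (push_uniformity h \<mu>) closure_of orbit G \<psi>' (h x) = h ` C"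
    unfolding orb' C_def by (rule uniform_topology_closure_of_push[OF inj le orb])
  have CX: "C \<subseteq> X"
    unfolding C_def
    using closure_of_subset_topspace[of "uniform_topology X \<mu>"] openin_topspace[of "uniform_topology X \<mu>"]
    unfolding openin_uniform_topology by blast
  have "h x \<in> Eq_points G (h ` C) (push_uniformity h (subspace_uniformity \<mu> C)) (restrict_action \<psi>' (h ` C))"
  proof (rule Eq_points_push[OF _ _ _ xC])
    show "inj_on h C" using inj CX by (rule inj_on_subset)
    show "subspace_uniformity \<mu> C \<le> principal (C \<times> C)" by (simp add: subspace_uniformity_def)
    show "restrict_action \<psi>' (h ` C) g (h y) = h (restrict_action \<psi> C g y)"
      if "g \<in> carrier G" "y \<in> C" for g y
      using eqv[of g y] that CX by (auto simp: restrict_action_def)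
  qed
  then show ?thesis
    using xX by (simp add: LE_points_def C' subspace_uniformity_push[OF inj le CX])
qed

lemma group_action_push:
  assumes act: "group_action G X \<psi>" and inj: "inj_on h X"
  shows "group_action G (h ` X) (\<lambda>g. restrict (\<lambda>z. h (\<psi> g (inv_into X h z))) (h ` X))"
    (is "group_action G ?X' ?\<psi>")
proof -
  interpret A: group_action G X \<psi> by (rule act)
  have G: "group G" using A.group_hom by (simp add: group_hom_def)
  have k: "inv_into X h (h x) = x" if "x \<in> X" for x using inj that by simp
  have \<psi>: "?\<psi> g (h x) = h (\<psi> g x)" if "x \<in> X" for g x using that k by simp
  have X: "\<psi> g x \<in> X" if "g \<in> carrier G" "x \<in> X" for g x
    using A.element_image[OF that] by blast
  have bij: "?\<psi> g \<in> Bij ?X'" if g: "g \<in> carrier G" for g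
  proof -
    have "inj_on (?\<psi> g) ?X'"
    proof (rule inj_onI)
      fix y z assume "y \<in> ?X'" "z \<in> ?X'" and eq: "?\<psi> g y = ?\<psi> g z"
      then obtain a b where ab: "y = h a" "z = h b" "a \<in> X" "b \<in> X" by blast
      then have "\<psi> g a = \<psi> g b"
        using eq \<psi> X[OF g] inj by (simp add: inj_on_eq_iff)
      then show "y = z" using ab A.inj_prop[OF g] by (simp add: inj_on_eq_iff)
    qed
    moreover have "?\<psi> g ` ?X' = h ` (\<psi> g ` X)"
      unfolding image_image using \<psi> by (intro image_cong) auto
    then have "?\<psi> g ` ?X' = ?X'" using A.surj_prop[OF g] by simp
    ultimately show ?thesis by (simp add: Bij_def bij_betw_def)
  qed
  have "?\<psi> (g \<otimes>\<^bsub>G\<^esub> g') = compose ?X' (?\<psi> g) (?\<psi> g')"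
    if "g \<in> carrier G" "g' \<in> carrier G" for g g'
  proof
    fix z show "?\<psi> (g \<otimes>\<^bsub>G\<^esub> g') z = compose ?X' (?\<psi> g) (?\<psi> g') z"
    proof (cases "z \<in> ?X'")
      case True
      then obtain x where x: "x \<in> X" "z = h x" by blast
      then have "\<psi> (g \<otimes>\<^bsub>G\<^esub> g') x = \<psi> g (\<psi> g' x)"
        using A.composition_rule that by simp
      then show ?thesis
        using x \<psi> X[OF that(2)] True by (simp add: compose_eq k)
    qed (simp add: compose_def)
  qed
  then have "?\<psi> \<in> hom G (BijGroup ?X')"
    using bij by (auto simp: hom_def BijGroup_def)
  then show ?thesis
    using G group_BijGroup
    by (auto intro!: group_action.intro group_hom.intro group_hom_axioms.intro)
qed

lemma factors_through_push:
  fixes Y :: "'y topology" and h :: "'y \<Rightarrow> 'z"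
  assumes Y: "G_space G T Y \<psi>" and inj: "inj_on h (topspace Y)"
    and f: "factors_through G X \<phi> Y \<psi> f"
  obtains Y' \<psi>' where "homeomorphic_map Y Y' h" "G_space G T Y' \<psi>'"
    "factors_through G X \<phi> Y' \<psi>' f"
    "\<And>g y. g \<in> carrier G \<Longrightarrow> y \<in> topspace Y \<Longrightarrow> \<psi>' g (h y) = h (\<psi> g y)"
proof -
  define k where "k = inv_into (topspace Y) h"
  have k: "k (h y) = y" if "y \<in> topspace Y" for y using inj that by (simp add: k_def)
  define Y' where "Y' = pullback_topology (h ` topspace Y) k Y"
  define \<psi>' where "\<psi>' = (\<lambda>g. restrict (\<lambda>z. h (\<psi> g (k z))) (h ` topspace Y))"
  have opY': "openin Y' V \<longleftrightarrow> (\<exists>U. openin Y U \<and> V = h ` U)" for V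
  proof -
    have "k -` U \<inter> h ` topspace Y = h ` U" if "openin Y U" for U
      using openin_subset[OF that] k by force
    then show ?thesis unfolding Y'_def openin_pullback_topology by metis
  qed
  have top: "topspace Y' = h ` topspace Y"
    unfolding Y'_def topspace_pullback_topology using k by force
  have hom: "homeomorphic_map Y Y' h"
  proof (rule bijective_open_imp_homeomorphic_map)
    show "continuous_map Y Y' h"
      unfolding continuous_map_def
    proof (intro conjI allI impI)
      show "h \<in> topspace Y \<rightarrow> topspace Y'" using top by blast
      fix V assume "openin Y' V"
      then obtain U where U: "openin Y U" "V = h ` U" using opY' by blast
      then have "{y \<in> topspace Y. h y \<in> V} = U"
        using inj_on_image_mem_iff[OF inj _ openin_subset[OF U(1)]] openin_subset[OF U(1)] by blast
      then show "openin Y {y \<in> topspace Y. h y \<in> V}" using U(1) by simp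
    qed
    show "open_map Y Y' h" unfolding open_map_def using opY' by blast
  qed (simp_all add: top inj)
  have conth: "continuous_map Y Y' h" using hom homeomorphic_imp_continuous_map by blast
  have contk: "continuous_map Y' Y k"
    unfolding continuous_map_def
  proof (intro conjI allI impI)
    show "k \<in> topspace Y' \<rightarrow> topspace Y" using top k by auto
    fix U assume U: "openin Y U"
    then have "{z \<in> topspace Y'. k z \<in> U} = h ` U"
      using openin_subset[OF U] k top by force
    then show "openin Y' {z \<in> topspace Y'. k z \<in> U}" using U opY' by auto
  qed
  have sp: "Y homeomorphic_space Y'" using hom homeomorphic_map_imp_homeomorphic_space by blast
  have \<psi>': "\<psi>' g (h y) = h (\<psi> g y)" if "y \<in> topspace Y" for g y
    using that k by (simp add: \<psi>'_def)
  have "G_space G T Y' \<psi>'"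
    unfolding G_space_def
  proof (intro conjI)
    show "Tychonoff_space Y'"
      using Y sp unfolding G_space_def Tychonoff_space_def
      by (metis homeomorphic_completely_regular_space homeomorphic_Hausdorff_space)
    show "group_action G (topspace Y') \<psi>'"
      unfolding top \<psi>'_def k_def
      by (rule group_action_push[OF _ inj]) (use Y in \<open>simp add: G_space_def\<close>)
    have "continuous_map (prod_topology T Y) Y (\<lambda>(g, y). \<psi> g y)"
      using Y by (simp add: G_space_def)
    moreover have "continuous_map (prod_topology T Y') (prod_topology T Y) (\<lambda>p. (fst p, k (snd p)))"
      by (intro continuous_map_pairedI continuous_map_fst continuous_map_compose[OF continuous_map_snd contk, unfolded o_def])
    ultimately have "continuous_map (prod_topology T Y') Y' (h \<circ> ((\<lambda>(g, y). \<psi> g y) \<circ> (\<lambda>p. (fst p, k (snd p)))))"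
      using conth by (intro continuous_map_compose)
    then show "continuous_map (prod_topology T Y') Y' (\<lambda>(g, z). \<psi>' g z)"
      by (rule continuous_map_eq) (auto simp: \<psi>'_def top)
  qed
  moreover have "factors_through G X \<phi> Y' \<psi>' f"
  proof -
    obtain \<nu> F where \<nu>: "continuous_map X Y \<nu>"
      and eqv: "\<forall>g\<in>carrier G. \<forall>x\<in>topspace X. \<nu> (\<phi> g x) = \<psi> g (\<nu> x)"
      and dense: "Y closure_of (\<nu> ` topspace X) = topspace Y"
      and F: "continuous_map Y euclideanreal F" "\<forall>x\<in>topspace X. f x = F (\<nu> x)"
      using f unfolding factors_through_def by (elim exE conjE)
    have \<nu>Y: "\<nu> x \<in> topspace Y" if "x \<in> topspace X" for x
      using \<nu> that by (auto simp: continuous_map_def)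
    then have im: "\<nu> ` topspace X \<subseteq> topspace Y" by blast
    show ?thesis
      unfolding factors_through_def
    proof (intro exI[of _ "h \<circ> \<nu>"] exI[of _ "F \<circ> k"] conjI ballI)
      show "continuous_map X Y' (h \<circ> \<nu>)" using \<nu> conth by (rule continuous_map_compose)
      show "continuous_map Y' euclideanreal (F \<circ> k)" using contk F(1) by (rule continuous_map_compose)
      show "Y' closure_of ((h \<circ> \<nu>) ` topspace X) = topspace Y'"
        unfolding image_comp[symmetric] homeomorphic_map_closure_of[OF hom im] dense top ..
      show "(h \<circ> \<nu>) (\<phi> g x) = \<psi>' g ((h \<circ> \<nu>) x)" if "g \<in> carrier G" "x \<in> topspace X" for g x
        using eqv that \<psi>'[OF \<nu>Y] by simp
      show "f x = (F \<circ> k) ((h \<circ> \<nu>) x)" if "x \<in> topspace X" for x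
        using F(2) that k[OF \<nu>Y] by simp
    qed
  qed
  ultimately show thesis using that hom \<psi>' by blast
qed

lemma dense_image_injection:
  fixes Y :: "'y topology" and X :: "'a topology"
  assumes haus: "Hausdorff_space Y" and dense: "Y closure_of (\<nu> ` topspace X) = topspace Y"
  shows "\<exists>h :: 'y \<Rightarrow> 'a set set. inj_on h (topspace Y)"
proof
  define h where "h y = {A. \<exists>U. openin Y U \<and> y \<in> U \<and> A = {x \<in> topspace X. \<nu> x \<in> U}}" for y
  show "inj_on h (topspace Y)"
  proof (rule inj_onI, rule ccontr)
    fix y z assume yz: "y \<in> topspace Y" "z \<in> topspace Y" "h y = h z" "y \<noteq> z"
    then obtain U V where UV: "openin Y U" "openin Y V" "y \<in> U" "z \<in> V" "disjnt U V"
      using haus unfolding Hausdorff_space_def by metis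
    then have "{x \<in> topspace X. \<nu> x \<in> U} \<in> h z"
      using yz(3) unfolding h_def by blast
    then obtain W where W: "openin Y W" "z \<in> W"
      and eq: "{x \<in> topspace X. \<nu> x \<in> U} = {x \<in> topspace X. \<nu> x \<in> W}"
      unfolding h_def by blast
    have VW: "z \<in> V \<inter> W \<and> openin Y (V \<inter> W)" using UV W by auto
    have "z \<in> Y closure_of (\<nu> ` topspace X)" using dense yz(2) by simp
    then have "\<exists>y. y \<in> \<nu> ` topspace X \<and> y \<in> V \<inter> W"
      unfolding in_closure_of by (elim conjE allE[of _ "V \<inter> W"]) (use VW in auto)
    then obtain x where x: "x \<in> topspace X" "\<nu> x \<in> V" "\<nu> x \<in> W" by auto
    then have "x \<in> {x \<in> topspace X. \<nu> x \<in> U}" unfolding eq by simp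
    then show False using x UV(5) by (auto simp: disjnt_iff)
  qed
qed

text \<open>
  Any factorisation through a compact SUC (LE) G-space, whatever the type of its points,
  yields an element of \<open>SUC_functions\<close> (\<open>LE_functions\<close>).
\<close>

theorem SUC_functions_any_type:
  fixes Y :: "'y topology" and X :: "'a topology"
  assumes tg: "topological_group G T" and bc: "bounded_continuous X f"
    and Y: "compact_SUC_G_space G T Y \<psi>" and f: "factors_through G X \<phi> Y \<psi> f"
  shows "f \<in> SUC_functions G T X \<phi>"
proof -
  have GY: "G_space G T Y \<psi>" and comp: "compact_space Y" and haus: "Hausdorff_space Y"
    and suc: "SUC_points G T (topspace Y) (compact_uniformity Y) \<psi> = topspace Y"
    using Y by (auto simp: compact_SUC_G_space_def G_space_def Tychonoff_space_def)
  obtain h :: "'y \<Rightarrow> 'a set set" where inj: "inj_on h (topspace Y)"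
    using f dense_image_injection[OF haus] unfolding factors_through_def by metis
  obtain Y' \<psi>' where hom: "homeomorphic_map Y Y' h" and GY': "G_space G T Y' \<psi>'"
    and f': "factors_through G X \<phi> Y' \<psi>' f"
    and eqv: "\<And>g y. g \<in> carrier G \<Longrightarrow> y \<in> topspace Y \<Longrightarrow> \<psi>' g (h y) = h (\<psi> g y)"
    using factors_through_push[OF GY inj f] by blast
  have top: "topspace Y' = h ` topspace Y" using hom homeomorphic_imp_surjective_map by blast
  have "h y \<in> SUC_points G T (topspace Y') (compact_uniformity Y') \<psi>'" if "y \<in> topspace Y" for y
    unfolding top compact_uniformity_push[OF comp haus hom]
    by (rule SUC_points_push[where \<psi> = \<psi>, OF tg inj]) (use that suc eqv in auto)
  then have "SUC_points G T (topspace Y') (compact_uniformity Y') \<psi>' = topspace Y'"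
    unfolding top by (auto simp: SUC_points_def)
  moreover have "compact_space Y'"
    using comp hom homeomorphic_map_imp_homeomorphic_space homeomorphic_compact_space by blast
  ultimately have "compact_SUC_G_space G T Y' \<psi>'"
    using GY' by (simp add: compact_SUC_G_space_def)
  then show ?thesis
    using bc f' unfolding SUC_functions_def by blast
qed

theorem LE_functions_any_type:
  fixes Y :: "'y topology" and X :: "'a topology"
  assumes bc: "bounded_continuous X f"
    and Y: "compact_LE_G_space G T Y \<psi>" and f: "factors_through G X \<phi> Y \<psi> f"
  shows "f \<in> LE_functions G T X \<phi>"
proof -
  have GY: "G_space G T Y \<psi>" and comp: "compact_space Y" and haus: "Hausdorff_space Y"
    and le: "LE_points G (topspace Y) (compact_uniformity Y) \<psi> = topspace Y"
    using Y by (auto simp: compact_LE_G_space_def G_space_def Tychonoff_space_def)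
  obtain h :: "'y \<Rightarrow> 'a set set" where inj: "inj_on h (topspace Y)"
    using f dense_image_injection[OF haus] unfolding factors_through_def by metis
  obtain Y' \<psi>' where hom: "homeomorphic_map Y Y' h" and GY': "G_space G T Y' \<psi>'"
    and f': "factors_through G X \<phi> Y' \<psi>' f"
    and eqv: "\<And>g y. g \<in> carrier G \<Longrightarrow> y \<in> topspace Y \<Longrightarrow> \<psi>' g (h y) = h (\<psi> g y)"
    using factors_through_push[OF GY inj f] by blast
  have top: "topspace Y' = h ` topspace Y" using hom homeomorphic_imp_surjective_map by blast
  have act: "\<psi> g y \<in> topspace Y" if "g \<in> carrier G" "y \<in> topspace Y" for g y
    using GY group_action.element_image[OF _ that refl] unfolding G_space_def by blast
  have "h y \<in> LE_points G (topspace Y') (compact_uniformity Y') \<psi>'" if "y \<in> topspace Y" for y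
    unfolding top compact_uniformity_push[OF comp haus hom]
    by (rule LE_points_push[where \<psi> = \<psi>,
          OF inj uniform_structureD(1)[OF compact_uniformity(1)[OF comp haus]]])
      (use that le act eqv in auto)
  then have "LE_points G (topspace Y') (compact_uniformity Y') \<psi>' = topspace Y'"
    unfolding top by (auto simp: LE_points_def)
  moreover have "compact_space Y'"
    using comp hom homeomorphic_map_imp_homeomorphic_space homeomorphic_compact_space by blast
  ultimately have "compact_LE_G_space G T Y' \<psi>'"
    using GY' by (simp add: compact_LE_G_space_def)
  then show ?thesis
    using bc f' unfolding LE_functions_def by blast
qed

end

theory Submission
  imports Defs
begin

text \<open>
  A point \<open>x\<^sub>0\<close> is a point of equicontinuity iff for every entourage \<open>E\<close> there is an entourage
  \<open>D\<close> such that \<open>(x\<^sub>0, x) \<in> D\<close> implies \<open>(g x\<^sub>0, g x) \<in> E\<close> for all \<open>g\<close>. In this form the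
  property passes to invariant subspaces at once; it extends from a dense invariant subspace
  because each single translation is uniformly continuous, so that \<open>g x\<close> can be replaced by
  \<open>g y\<close> for a point \<open>y\<close> of the subspace chosen depending on \<open>g\<close>. If \<open>x\<^sub>0\<close> is a point of
  equicontinuity of its orbit closure, then for \<open>u\<close> near the neutral element the point
  \<open>u x\<^sub>0\<close> of the orbit is near \<open>x\<^sub>0\<close>, hence \<open>g u x\<^sub>0\<close> is near \<open>g x\<^sub>0\<close> uniformly in \<open>g\<close>. The
  last argument uses only the continuity of the action, so it applies verbatim to a compact
  G-space with its unique uniformity.
\<close>

section \<open>The uniform structure induced on a subset\<close>

lemma topspace_uniform_topology:
  assumes "uniform_structure X \<mu>"
  shows "topspace (uniform_topology X \<mu>) = X"
proof
  show "topspace (uniform_topology X \<mu>) \<subseteq> X"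
    by (rule conjunct1[OF iffD1[OF openin_uniform_topology openin_topspace]])
  have "openin (uniform_topology X \<mu>) X"
    unfolding openin_uniform_topology
  proof (intro conjI ballI)
    show "eventually (\<lambda>(x', y). x' = x \<longrightarrow> y \<in> X) \<mu>" for x
      using uniform_structure_carrier[OF assms] by eventually_elim auto
  qed simp
  then show "X \<subseteq> topspace (uniform_topology X \<mu>)" by (rule openin_subset)
qed

lemma eventually_subspace_uniformity:
  "eventually E (subspace_uniformity \<mu> S) \<longleftrightarrow> eventually (\<lambda>p. p \<in> S \<times> S \<longrightarrow> E p) \<mu>"
  by (simp add: subspace_uniformity_def eventually_inf_principal)

text \<open>The axioms are inherited because an entourage of \<open>S\<close> becomes one of \<mu>
  once it is declared true off \<open>S \<times> S\<close>. This makes \<open>Eq_points_iff\<close>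
  available on \<open>S\<close>.\<close>

lemma uniform_structure_subspace:
  assumes U: "uniform_structure X \<mu>" and S: "S \<subseteq> X"
  shows "uniform_structure S (subspace_uniformity \<mu> S)"
  unfolding uniform_structure_def
proof (intro conjI allI impI)
  show "subspace_uniformity \<mu> S \<le> principal (S \<times> S)"
    by (simp add: subspace_uniformity_def)
  fix E assume "eventually E (subspace_uniformity \<mu> S)"
  then have E: "eventually (\<lambda>p. p \<in> S \<times> S \<longrightarrow> E p) \<mu>"
    by (simp only: eventually_subspace_uniformity)
  show "\<forall>x\<in>S. E (x, x)"
    using uniform_structureD(2)[OF U E] S by blast
  show "eventually (\<lambda>(x, y). E (y, x)) (subspace_uniformity \<mu> S)"
    unfolding eventually_subspace_uniformity
    using uniform_structureD(3)[OF U E] by eventually_elim auto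
  obtain D where D: "eventually D \<mu>"
    and DE: "\<forall>x\<in>X. \<forall>y\<in>X. \<forall>z\<in>X. D (x, y) \<longrightarrow> D (y, z) \<longrightarrow> (x, z) \<in> S \<times> S \<longrightarrow> E (x, z)"
    using uniform_structureD(4)[OF U E] by blast
  have "eventually D (subspace_uniformity \<mu> S)"
    unfolding eventually_subspace_uniformity using D by eventually_elim simp
  moreover have "\<forall>x\<in>S. \<forall>y\<in>S. \<forall>z\<in>S. D (x, y) \<longrightarrow> D (y, z) \<longrightarrow> E (x, z)"
    using DE S by (meson SigmaI subsetD)
  ultimately show "\<exists>D. eventually D (subspace_uniformity \<mu> S) \<and>
      (\<forall>x\<in>S. \<forall>y\<in>S. \<forall>z\<in>S. D (x, y) \<longrightarrow> D (y, z) \<longrightarrow> E (x, z))"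
    by blast
qed

section \<open>Equicontinuity in terms of entourages\<close>

lemma Eq_points_iff:
  assumes U: "uniform_structure X \<mu>"
  shows "x\<^sub>0 \<in> Eq_points G X \<mu> \<phi> \<longleftrightarrow>
    x\<^sub>0 \<in> X \<and> (\<forall>E. eventually E \<mu> \<longrightarrow>
      (\<exists>D. eventually D \<mu> \<and>
        (\<forall>x\<in>X. D (x\<^sub>0, x) \<longrightarrow> (\<forall>g\<in>carrier G. E (\<phi> g x\<^sub>0, \<phi> g x)))))"
    (is "?L \<longleftrightarrow> ?R")
proof
  assume L: ?L
  show ?R
  proof (intro conjI allI impI)
    show "x\<^sub>0 \<in> X" using L by (simp add: Eq_points_def)
    fix E assume "eventually E \<mu>"
    from Eq_pointsD[OF L this]
    obtain V where op: "openin (uniform_topology X \<mu>) V" and x: "x\<^sub>0 \<in> V"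
      and V: "\<forall>y\<in>V. \<forall>g\<in>carrier G. E (\<phi> g x\<^sub>0, \<phi> g y)" by blast
    \<comment> \<open>Openness of \<open>V\<close> says exactly that this predicate is an entourage.
      Its section at \<open>x\<^sub>0\<close> is \<open>V\<close>, so it serves as
      \<open>D\<close>.\<close>
    have "eventually (\<lambda>(x', y). x' = x\<^sub>0 \<longrightarrow> y \<in> V) \<mu>"
      using iffD1[OF openin_uniform_topology op] x by blast
    with V show "\<exists>D. eventually D \<mu> \<and>
        (\<forall>x\<in>X. D (x\<^sub>0, x) \<longrightarrow> (\<forall>g\<in>carrier G. E (\<phi> g x\<^sub>0, \<phi> g x)))"
      by (intro exI[of _ "\<lambda>(x', y). x' = x\<^sub>0 \<longrightarrow> y \<in> V"]) simp
  qed
next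
  assume R: ?R
  show ?L
    unfolding Eq_points_def mem_Collect_eq
  proof (intro conjI allI impI)
    show x: "x\<^sub>0 \<in> X" using R by (rule conjunct1)
    fix E assume "eventually E \<mu>"
    from R[THEN conjunct2, rule_format, OF this]
    obtain D where D: "eventually D \<mu>"
      and DE: "\<forall>x\<in>X. D (x\<^sub>0, x) \<longrightarrow> (\<forall>g\<in>carrier G. E (\<phi> g x\<^sub>0, \<phi> g x))" by blast
    \<comment> \<open>The section of \<open>D\<close> at \<open>x\<^sub>0\<close> may fail to be
      open, but it contains an open neighbourhood.\<close>
    obtain V where V: "openin (uniform_topology X \<mu>) V" "x\<^sub>0 \<in> V" "\<forall>y\<in>V. D (x\<^sub>0, y)"
      using uniform_section_neighbourhood[OF U D x] by blast
    have "V \<subseteq> X" using V(1) unfolding openin_uniform_topology by (rule conjunct1)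
    with V DE show "\<exists>V. openin (uniform_topology X \<mu>) V \<and> x\<^sub>0 \<in> V \<and>
        (\<forall>x\<in>V. \<forall>g\<in>carrier G. E (\<phi> g x\<^sub>0, \<phi> g x))"
      by (intro exI[of _ V]) blast
  qed
qed

text \<open>Removes the trace uniformity and the restricted action, so that subspace and whole space
  are compared through the same entourages. Invariance keeps translates of points of
  \<open>S\<close> in \<open>S\<close>, where an entourage of \<open>S\<close> and its extension by
  truth agree.\<close>

lemma Eq_points_subspace_iff:
  assumes U: "uniform_structure X \<mu>" and S: "S \<subseteq> X" and inv: "G_invariant G \<phi> S"
  shows "x\<^sub>0 \<in> Eq_points G S (subspace_uniformity \<mu> S) (restrict_action \<phi> S) \<longleftrightarrow>
    x\<^sub>0 \<in> S \<and> (\<forall>E. eventually E \<mu> \<longrightarrow>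
      (\<exists>D. eventually D \<mu> \<and>
        (\<forall>x\<in>S. D (x\<^sub>0, x) \<longrightarrow> (\<forall>g\<in>carrier G. E (\<phi> g x\<^sub>0, \<phi> g x)))))"
    (is "?L \<longleftrightarrow> ?R")
proof -
  have act: "\<phi> g x \<in> S" if "g \<in> carrier G" "x \<in> S" for g x
    using inv that by (auto simp: G_invariant_def)
  note iff = Eq_points_iff[OF uniform_structure_subspace[OF U S]]
  show ?thesis
  proof
    assume L: ?L
    note L' = L[unfolded iff, THEN conjunct2, rule_format]
    show ?R
    proof (intro conjI allI impI)
      show x0: "x\<^sub>0 \<in> S" using L by (simp add: Eq_points_def)
      fix E assume "eventually E \<mu>"
      then have "eventually E (subspace_uniformity \<mu> S)"
        unfolding eventually_subspace_uniformity by eventually_elim simp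
      from L'[OF this] obtain D where "eventually D (subspace_uniformity \<mu> S)"
        and "\<forall>x\<in>S. D (x\<^sub>0, x) \<longrightarrow>
          (\<forall>g\<in>carrier G. E (restrict_action \<phi> S g x\<^sub>0, restrict_action \<phi> S g x))" by blast
      \<comment> \<open>\<open>D\<close> is only an entourage of \<open>S\<close>; made true off
        \<open>S \<times> S\<close>, it is an entourage of \<mu> with the same sections inside
        \<open>S\<close>.\<close>
      then show "\<exists>D. eventually D \<mu> \<and>
          (\<forall>x\<in>S. D (x\<^sub>0, x) \<longrightarrow> (\<forall>g\<in>carrier G. E (\<phi> g x\<^sub>0, \<phi> g x)))"
        using x0 unfolding eventually_subspace_uniformity
        by (intro exI[of _ "\<lambda>p. p \<in> S \<times> S \<longrightarrow> D p"]) (simp add: restrict_action_def)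
    qed
  next
    assume R: ?R
    note R' = R[THEN conjunct2, rule_format]
    show ?L
      unfolding iff
    proof (intro conjI allI impI)
      show x0: "x\<^sub>0 \<in> S" using R by (rule conjunct1)
      fix E assume "eventually E (subspace_uniformity \<mu> S)"
      then have "eventually (\<lambda>p. p \<in> S \<times> S \<longrightarrow> E p) \<mu>"
        by (simp only: eventually_subspace_uniformity)
      from R'[OF this] obtain D where D: "eventually D \<mu>"
        and DE: "\<And>x g. x \<in> S \<Longrightarrow> D (x\<^sub>0, x) \<Longrightarrow> g \<in> carrier G \<Longrightarrow>
          (\<phi> g x\<^sub>0, \<phi> g x) \<in> S \<times> S \<Longrightarrow> E (\<phi> g x\<^sub>0, \<phi> g x)" by blast
      have "eventually D (subspace_uniformity \<mu> S)"
        unfolding eventually_subspace_uniformity using D by eventually_elim simp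
      \<comment> \<open>The membership premise of \<open>DE\<close> holds by invariance of
        \<open>S\<close>.\<close>
      moreover have "E (restrict_action \<phi> S g x\<^sub>0, restrict_action \<phi> S g x)"
        if "x \<in> S" "D (x\<^sub>0, x)" "g \<in> carrier G" for x g
        using DE[OF that] act that x0 by (simp add: restrict_action_def)
      ultimately show "\<exists>D. eventually D (subspace_uniformity \<mu> S) \<and>
          (\<forall>x\<in>S. D (x\<^sub>0, x) \<longrightarrow>
            (\<forall>g\<in>carrier G. E (restrict_action \<phi> S g x\<^sub>0, restrict_action \<phi> S g x)))"
        by (intro exI[of _ D]) blast
    qed
  qed
qed

section \<open>Restriction to invariant subspaces and extension from dense ones\<close>

lemma Eq_points_subspaceI:
  assumes U: "uniform_structure X \<mu>" and S: "S \<subseteq> X" and inv: "G_invariant G \<phi> S"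
    and x: "x \<in> Eq_points G X \<mu> \<phi>" "x \<in> S"
  shows "x \<in> Eq_points G S (subspace_uniformity \<mu> S) (restrict_action \<phi> S)"
  unfolding Eq_points_subspace_iff[OF U S inv]
proof (intro conjI allI impI)
  note x' = x(1)[unfolded Eq_points_iff[OF U], THEN conjunct2, rule_format]
  fix E assume "eventually E \<mu>"
  from x'[OF this] S show "\<exists>D. eventually D \<mu> \<and>
      (\<forall>y\<in>S. D (x, y) \<longrightarrow> (\<forall>g\<in>carrier G. E (\<phi> g x, \<phi> g y)))"
    by (elim ex_forward) blast
qed (rule x(2))

text \<open>For \<open>x\<close> near \<open>y\<close>, pick \<open>z\<close> in \<open>S\<close>
  near \<open>x\<close> and go from \<open>g y\<close> to \<open>g z\<close> by equicontinuity on
  \<open>S\<close>, then to \<open>g x\<close> by uniform continuity of \<open>g\<close>. The point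
  \<open>z\<close> depends on \<open>g\<close>, but \<open>B\<close> is fixed before
  \<open>g\<close>, which gives uniformity.\<close>

lemma Eq_points_dense_subspaceD:
  assumes U: "uniform_structure X \<mu>"
    and iso: "\<And>g. g \<in> carrier G \<Longrightarrow> uniform_isomorphism X \<mu> X \<mu> (\<phi> g)"
    and S: "S \<subseteq> X" and inv: "G_invariant G \<phi> S"
    and dense: "uniform_topology X \<mu> closure_of S = X"
    and y: "y \<in> Eq_points G S (subspace_uniformity \<mu> S) (restrict_action \<phi> S)"
  shows "y \<in> Eq_points G X \<mu> \<phi>"
  unfolding Eq_points_iff[OF U]
proof (intro conjI allI impI)
  note y' = y[unfolded Eq_points_subspace_iff[OF U S inv]]
  show yX: "y \<in> X" using conjunct1[OF y'] S by blast
  fix E assume "eventually E \<mu>"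
  then obtain D where D: "eventually D \<mu>"
    and DE: "\<forall>x\<in>X. \<forall>y\<in>X. \<forall>z\<in>X. D (x, y) \<longrightarrow> D (y, z) \<longrightarrow> E (x, z)"
    using uniform_structureD(4)[OF U] by blast
  from y'[THEN conjunct2, rule_format, OF D]
  obtain C where C: "eventually C \<mu>"
    and CD: "\<forall>x\<in>S. C (y, x) \<longrightarrow> (\<forall>g\<in>carrier G. D (\<phi> g y, \<phi> g x))" by blast
  obtain B where B: "eventually B \<mu>"
    and BC: "\<forall>x\<in>X. \<forall>y\<in>X. \<forall>z\<in>X. B (x, y) \<longrightarrow> B (y, z) \<longrightarrow> C (x, z)"
    using uniform_structureD(4)[OF U C] by blast
  have "E (\<phi> g y, \<phi> g x)" if x: "x \<in> X" "B (y, x)" and g: "g \<in> carrier G" for x g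
  proof -
    have act: "\<phi> g z \<in> X" if "z \<in> X" for z
      using iso[OF g] that by (auto simp: uniform_isomorphism_def bij_betw_def)
    have "eventually (\<lambda>p. D (map_prod (\<phi> g) (\<phi> g) p)) \<mu>"
      using iso[OF g] D by (auto simp: uniform_isomorphism_def filterlim_iff)
    \<comment> \<open>The \<open>D\<close> part is transposed because the chain from
      \<open>g y\<close> to \<open>g x\<close> ends with the pair
      \<open>(\<phi> g z, \<phi> g x)\<close>, whereas the section is taken at
      \<open>x\<close>.\<close>
    from uniform_structureD(3)[OF U this] B
    have "eventually (\<lambda>(a, b). B (a, b) \<and> D (\<phi> g b, \<phi> g a)) \<mu>"
      by eventually_elim auto
    from uniform_section_neighbourhood[OF U this x(1)]
    obtain V where V: "openin (uniform_topology X \<mu>) V" "x \<in> V"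
      and BD: "\<forall>z\<in>V. B (x, z) \<and> D (\<phi> g z, \<phi> g x)" by auto
    have "x \<in> uniform_topology X \<mu> closure_of S" using dense x(1) by simp
    then obtain z where z: "z \<in> S" "z \<in> V" using V unfolding in_closure_of by blast
    then have zX: "z \<in> X" using S by blast
    have "C (y, z)" using BC yX x zX BD z(2) by blast
    then have "D (\<phi> g y, \<phi> g z)" using CD z(1) g by blast
    then show ?thesis using DE act yX zX x(1) BD z(2) by blast
  qed
  with B show "\<exists>D. eventually D \<mu> \<and>
      (\<forall>x\<in>X. D (y, x) \<longrightarrow> (\<forall>g\<in>carrier G. E (\<phi> g y, \<phi> g x)))"
    by (intro exI[of _ B]) blast
qed

section \<open>Translations, orbits and closures in G-spaces\<close>

lemma G_space_continuous_translation:
  assumes T: "topspace T = carrier G" and X: "G_space G T X \<phi>" and g: "g \<in> carrier G"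
  shows "continuous_map X X (\<phi> g)"
proof -
  have "continuous_map X (prod_topology T X) (\<lambda>x. (g, x))"
    using g T by (intro continuous_map_pairedI) auto
  moreover have "continuous_map (prod_topology T X) X (\<lambda>(g, x). \<phi> g x)"
    using X by (simp add: G_space_def)
  ultimately have "continuous_map X X ((\<lambda>(g, x). \<phi> g x) \<circ> (\<lambda>x. (g, x)))"
    by (rule continuous_map_compose)
  then show ?thesis by (simp add: o_def)
qed

lemma G_space_continuous_orbit_map:
  assumes X: "G_space G T X \<phi>" and x: "x \<in> topspace X"
  shows "continuous_map T X (\<lambda>g. \<phi> g x)"
proof -
  have "continuous_map T (prod_topology T X) (\<lambda>g. (g, x))"
    using x by (intro continuous_map_pairedI) auto
  moreover have "continuous_map (prod_topology T X) X (\<lambda>(g, x). \<phi> g x)"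
    using X by (simp add: G_space_def)
  ultimately have "continuous_map T X ((\<lambda>(g, x). \<phi> g x) \<circ> (\<lambda>g. (g, x)))"
    by (rule continuous_map_compose)
  then show ?thesis by (simp add: o_def)
qed

lemma G_invariant_closure_of:
  assumes T: "topspace T = carrier G" and X: "G_space G T X \<phi>" and S: "G_invariant G \<phi> S"
  shows "G_invariant G \<phi> (X closure_of S)"
  unfolding G_invariant_def
proof
  fix g assume g: "g \<in> carrier G"
  have "\<phi> g ` (X closure_of S) \<subseteq> X closure_of (\<phi> g ` S)"
    using continuous_map_image_closure_subset[OF G_space_continuous_translation[OF T X g]] .
  also have "\<dots> \<subseteq> X closure_of S"
    using S g by (intro closure_of_mono) (simp add: G_invariant_def)
  finally show "\<phi> g ` (X closure_of S) \<subseteq> X closure_of S" .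
qed

lemma (in group_action) G_invariant_orbit:
  assumes "x \<in> E"
  shows "G_invariant G \<phi> (orbit G \<phi> x)"
proof -
  interpret group G using group_hom by (rule group_hom.axioms(1))
  have "\<phi> g (\<phi> h x) \<in> orbit G \<phi> x" if gh: "g \<in> carrier G" "h \<in> carrier G" for g h
  proof -
    have "\<phi> g (\<phi> h x) = \<phi> (g \<otimes> h) x" using assms gh by (simp add: composition_rule)
    moreover have "g \<otimes> h \<in> carrier G" using gh by simp
    ultimately show ?thesis unfolding orbit_def by blast
  qed
  then show ?thesis by (auto simp: G_invariant_def orbit_def)
qed

section \<open>Inclusions between the sets of points\<close>

context
  fixes G :: "('g, 'm) monoid_scheme" (structure) and T :: "'g topology"
    and X :: "'a set" and \<mu> \<phi>
  assumes T: "topspace T = carrier G"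
    and U: "uniform_structure X \<mu>"
    and act: "G_space G T (uniform_topology X \<mu>) \<phi>"
begin

interpretation A: group_action G X \<phi>
  using act by (simp add: G_space_def topspace_uniform_topology[OF U])

text \<open>Supplies what the subspace lemmas require of the orbit closure. Its invariance comes
  from that of the orbit by continuity of translations.\<close>

lemma orbit_closure:
  assumes x: "x \<in> X"
  defines "C \<equiv> uniform_topology X \<mu> closure_of orbit G \<phi> x"
  shows "C \<subseteq> X" "orbit G \<phi> x \<subseteq> C" "x \<in> C" "G_invariant G \<phi> C"
proof -
  note top = topspace_uniform_topology[OF U]
  show "C \<subseteq> X" unfolding C_def using closure_of_subset_topspace top by metis
  have "orbit G \<phi> x \<subseteq> X"
    using A.element_image x by (auto simp: orbit_def)
  then show *: "orbit G \<phi> x \<subseteq> C"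
    unfolding C_def by (intro closure_of_subset) (simp add: top)
  show "x \<in> C" using A.orbit_refl[OF x] * by blast
  show "G_invariant G \<phi> C"
    unfolding C_def by (rule G_invariant_closure_of[OF T act A.G_invariant_orbit[OF x]])
qed

lemma Eq_points_subset_LE_points: "Eq_points G X \<mu> \<phi> \<subseteq> LE_points G X \<mu> \<phi>"
proof
  fix x assume x: "x \<in> Eq_points G X \<mu> \<phi>"
  then have xX: "x \<in> X" by (simp add: Eq_points_def)
  note C = orbit_closure[OF xX]
  show "x \<in> LE_points G X \<mu> \<phi>"
    using Eq_points_subspaceI[OF U C(1,4) x C(3)] xX by (simp add: LE_points_def Let_def)
qed

lemma LE_points_subset_SUC_points: "LE_points G X \<mu> \<phi> \<subseteq> SUC_points G T X \<mu> \<phi>"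
proof
  fix x assume x: "x \<in> LE_points G X \<mu> \<phi>"
  then have xX: "x \<in> X" by (simp add: LE_points_def)
  define C where "C = uniform_topology X \<mu> closure_of orbit G \<phi> x"
  note C = orbit_closure[OF xX, folded C_def]
  have "x \<in> Eq_points G C (subspace_uniformity \<mu> C) (restrict_action \<phi> C)"
    using x unfolding LE_points_def C_def Let_def by blast
  note eq = this[unfolded Eq_points_subspace_iff[OF U C(1,4)]]
  show "x \<in> SUC_points G T X \<mu> \<phi>"
    unfolding SUC_points_def mem_Collect_eq
  proof (intro conjI allI impI)
    show "x \<in> X" by (rule xX)
    fix E assume E: "eventually E \<mu>"
    \<comment> \<open>Equicontinuity puts the translate of the base point first, while
      \<open>SUC_points\<close> puts it second; hence the transposed entourage.\<close>
    from eq[THEN conjunct2, rule_format, OF uniform_structureD(3)[OF U E]]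
    obtain D where D: "eventually D \<mu>"
      and DE: "\<forall>z\<in>C. D (x, z) \<longrightarrow> (\<forall>g\<in>carrier G. E (\<phi> g z, \<phi> g x))" by auto
    obtain V where V: "openin (uniform_topology X \<mu>) V" "x \<in> V" "\<forall>z\<in>V. D (x, z)"
      using uniform_section_neighbourhood[OF U D xX] by blast
    \<comment> \<open>The preimage of \<open>V\<close> under the orbit map of \<open>x\<close>; it
      is a neighbourhood of the neutral element, which fixes \<open>x\<close>.\<close>
    define W where "W = {u \<in> carrier G. \<phi> u x \<in> V}"
    have "openin T W"
      using openin_continuous_map_preimage[OF G_space_continuous_orbit_map[OF act] V(1)] xX T
      by (simp add: W_def topspace_uniform_topology[OF U])
    moreover have "\<one> \<in> W"
      using V(2) fun_cong[OF A.id_eq_one, of x] xX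
        group.is_monoid[OF group_hom.axioms(1)[OF A.group_hom]]
      by (simp add: W_def monoid.one_closed)
    moreover have "E (\<phi> (g \<otimes> u) x, \<phi> g x)" if "g \<in> carrier G" "u \<in> W" for g u
    proof -
      have u: "u \<in> carrier G" "D (x, \<phi> u x)" using that V(3) by (auto simp: W_def)
      \<comment> \<open>Equicontinuity is known only on \<open>C\<close>, and
        \<open>\<phi> u x\<close> lies there as a point of the orbit.\<close>
      then have "\<phi> u x \<in> C" using C(2) by (auto simp: orbit_def)
      then show ?thesis
        using DE u that(1) xX by (simp add: A.composition_rule)
    qed
    ultimately show "\<exists>U. openin T U \<and> \<one> \<in> U \<and>
        (\<forall>g\<in>carrier G. \<forall>u\<in>U. E (\<phi> (g \<otimes> u) x, \<phi> g x))"
      by (intro exI[of _ W]) blast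
  qed
qed

end

section \<open>Compact G-spaces and the function classes\<close>

lemma compact_LE_imp_SUC_G_space:
  assumes T: "topspace T = carrier G" and Y: "compact_LE_G_space G T Y \<psi>"
  shows "compact_SUC_G_space G T Y \<psi>"
proof -
  have *: "compact_space Y" "Hausdorff_space Y" and act: "G_space G T Y \<psi>"
    and le: "LE_points G (topspace Y) (compact_uniformity Y) \<psi> = topspace Y"
    using Y by (auto simp: compact_LE_G_space_def G_space_def Tychonoff_space_def)
  note cu = compact_uniformity[OF *]
  \<comment> \<open>The compact uniformity induces the topology of \<open>Y\<close>, so rewriting
    with \<open>cu(2)\<close> turns the hypothesis on the action into \<open>act\<close>.\<close>
  have "topspace Y \<subseteq> SUC_points G T (topspace Y) (compact_uniformity Y) \<psi>"
    using LE_points_subset_SUC_points[OF T cu(1), unfolded cu(2), OF act] le by simp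
  then show ?thesis
    using * act unfolding compact_SUC_G_space_def by (auto simp: SUC_points_def)
qed

theorem lemma7p8:
  fixes G :: "('g, 'm) monoid_scheme" and T :: "'g topology"
  assumes "topological_group G T"
  shows
    "(\<forall>(X :: 'a set) \<mu> \<phi> Y y\<^sub>0.
        uniform_G_space G T X \<mu> \<phi> \<and> Y \<subseteq> X \<and> G_invariant G \<phi> Y \<and>
        uniform_topology X \<mu> closure_of Y = X \<and> y\<^sub>0 \<in> Y \<longrightarrow>
        (y\<^sub>0 \<in> Eq_points G X \<mu> \<phi> \<longleftrightarrow>
         y\<^sub>0 \<in> Eq_points G Y (subspace_uniformity \<mu> Y) (restrict_action \<phi> Y))) \<and>
     (\<forall>(X :: 'b set) \<mu> \<phi>.
        uniform_G_space G T X \<mu> \<phi> \<longrightarrow>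
        LE_points G X \<mu> \<phi> \<subseteq> SUC_points G T X \<mu> \<phi> \<and>
        Eq_points G X \<mu> \<phi> \<subseteq> LE_points G X \<mu> \<phi>) \<and>
     (\<forall>(X :: 'c topology) \<phi>.
        G_space G T X \<phi> \<longrightarrow> LE_functions G T X \<phi> \<subseteq> SUC_functions G T X \<phi>)"
proof -
  have T: "topspace T = carrier G"
    using assms by (rule topological_group.topspace_eq_carrier)
  show ?thesis
  proof (intro conjI allI impI; (elim conjE)?)
    fix X :: "'a set" and \<mu> \<phi> Y y\<^sub>0
    assume X: "uniform_G_space G T X \<mu> \<phi>" and Y: "Y \<subseteq> X" "G_invariant G \<phi> Y"
      and dense: "uniform_topology X \<mu> closure_of Y = X" and y: "y\<^sub>0 \<in> Y"
    have U: "uniform_structure X \<mu>"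
      and iso: "\<And>g. g \<in> carrier G \<Longrightarrow> uniform_isomorphism X \<mu> X \<mu> (\<phi> g)"
      using X by (auto simp: uniform_G_space_def)
    show "y\<^sub>0 \<in> Eq_points G X \<mu> \<phi> \<longleftrightarrow>
        y\<^sub>0 \<in> Eq_points G Y (subspace_uniformity \<mu> Y) (restrict_action \<phi> Y)"
      using Eq_points_subspaceI[OF U Y _ y] Eq_points_dense_subspaceD[OF U iso Y dense] by blast
  next
    fix X :: "'b set" and \<mu> \<phi>
    assume "uniform_G_space G T X \<mu> \<phi>"
    then have X: "uniform_structure X \<mu>" "G_space G T (uniform_topology X \<mu>) \<phi>"
      by (simp_all add: uniform_G_space_def)
    show "LE_points G X \<mu> \<phi> \<subseteq> SUC_points G T X \<mu> \<phi>"
      by (rule LE_points_subset_SUC_points[OF T X])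
    show "Eq_points G X \<mu> \<phi> \<subseteq> LE_points G X \<mu> \<phi>"
      by (rule Eq_points_subset_LE_points[OF T X])
  next
    fix X :: "'c topology" and \<phi>
    show "LE_functions G T X \<phi> \<subseteq> SUC_functions G T X \<phi>"
      \<comment> \<open>Both classes range over spaces with points in \<open>'c set set\<close>, so
        the same \<open>Y\<close>, action and factorisation witness membership.\<close>
      unfolding LE_functions_def SUC_functions_def
      using compact_LE_imp_SUC_G_space[OF T] by blast
  qed
qed

end
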